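(* Let $\mathbb{F}$ be a field with $\mathrm{char}(\mathbb{F})=0$. Let $f=x_1\cdots x_n$ and $g=x_1+\cdots+x_n-n$ with $f,g\in\mathbb{F}[x_1,\ldots,x_n]$. Then the system $f,g,\{x_i^2-x_i\}_{i=1}^n$ is unsatisfiable and any $\sum\bigwedge\sum$-IPS refutation of it requires size at least $\exp(\Omega(n))$.
   Context: An IPS refutation of $f,g,\{x_i^2-x_i\}_i$ is a polynomial $C(\overline{x},y,z,\overline{w})\in\mathbb{F}[x_1,\ldots,x_n,y,z,w_1,\ldots,w_n]$ (of arbitrary degree in $y,z,\overline{w}$), given by an algebraic circuit, with $C(\overline{x},0,0,\overline{0})=0$ and $C(\overline{x},f,g,x_1^2-x_1,\ldots,x_n^2-x_n)=1$ as polynomial identities. It is a $\sum\bigwedge\sum$-IPS refutation if $C$ is given by a depth-3 powering formula, i.e. $C=\sum_{i=1}^s\ell_i^{d_i}$ with $\ell_i$ affine linear functions in the $N=2n+2$ variables of $C$; its size is $N\cdot\sum_{i=1}^s(d_i+1)$. Unsatisfiable means no common zero. The constant in $\Omega$ is absolute and positive. *)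

theory Defs
  imports Complex_Main "HOL-Library.Poly_Mapping"
begin

text \<open>Multivariate polynomials with variables in \<open>'v\<close>: finitely supported maps from exponent
  vectors to coefficients, with the convolution product of \<open>Poly_Mapping\<close>.\<close>

type_synonym ('v, 'a) mpoly = "('v \<Rightarrow>\<^sub>0 nat) \<Rightarrow>\<^sub>0 'a"

definition Const :: "'a::zero \<Rightarrow> ('v, 'a) mpoly" where
  "Const c = Poly_Mapping.single 0 c"

definition Var :: "'v \<Rightarrow> ('v, 'a::zero_neq_one) mpoly" where
  "Var v = Poly_Mapping.single (Poly_Mapping.single v 1) 1"

definition poly_ring :: "'v set \<Rightarrow> ('v, 'a::zero) mpoly set" where
  "poly_ring V = {p. \<forall>m\<in>Poly_Mapping.keys p. Poly_Mapping.keys m \<subseteq> V}"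

text \<open>Evaluation at \<open>\<sigma>\<close> in a ring \<open>'b\<close>, the coefficients being mapped by \<open>h\<close>. It specializes to
  evaluation at a point and to substitution of polynomials for variables.\<close>

definition eval_via ::
    "('a \<Rightarrow> 'b) \<Rightarrow> ('v \<Rightarrow> 'b) \<Rightarrow> ('v, 'a::zero) mpoly \<Rightarrow> 'b::comm_semiring_1" where
  "eval_via h \<sigma> p =
     (\<Sum>m\<in>Poly_Mapping.keys p. h (Poly_Mapping.lookup p m) *
        (\<Prod>v\<in>Poly_Mapping.keys m. \<sigma> v ^ Poly_Mapping.lookup m v))"

definition poly_eval :: "('v \<Rightarrow> 'a) \<Rightarrow> ('v, 'a::comm_semiring_1) mpoly \<Rightarrow> 'a" where
  "poly_eval = eval_via (\<lambda>c. c)"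

definition subst ::
    "('v \<Rightarrow> ('w, 'a) mpoly) \<Rightarrow> ('v, 'a::comm_semiring_1) mpoly \<Rightarrow> ('w, 'a) mpoly" where
  "subst = eval_via Const"

lemma poly_eval_Var: "poly_eval \<sigma> (Var v) = \<sigma> v"
  by (simp add: poly_eval_def eval_via_def Var_def)

lemma poly_eval_Const: "poly_eval \<sigma> (Const c) = c"
  by (simp add: poly_eval_def eval_via_def Const_def)

lemma subst_Var: "subst \<sigma> (Var v) = (\<sigma> v :: ('w, 'a::comm_semiring_1) mpoly)"
  by (simp add: subst_def eval_via_def Var_def Const_def)

lemma subst_Const: "subst \<sigma> (Const c) = Const c"
  by (simp add: subst_def eval_via_def Const_def)

definition affine_linear :: "'v set \<Rightarrow> ('v, 'a::comm_ring_1) mpoly \<Rightarrow> bool" where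
  "affine_linear V l \<longleftrightarrow> (\<exists>a b. l = (\<Sum>v\<in>V. Const (a v) * Var v) + Const b)"

text \<open>The polynomials \<open>f, g\<close> have variables \<open>x\<^sub>1, \<dots>, x\<^sub>n\<close>, indexed by \<open>1, \<dots>, n\<close>.\<close>

definition boolean_axiom :: "nat \<Rightarrow> (nat, 'a::comm_ring_1) mpoly" where
  "boolean_axiom i = (Var i)\<^sup>2 - Var i"

definition unsatisfiable ::
    "nat \<Rightarrow> (nat, 'a::comm_ring_1) mpoly \<Rightarrow> (nat, 'a) mpoly \<Rightarrow> bool" where
  "unsatisfiable n f g \<longleftrightarrow>
     \<not> (\<exists>x :: nat \<Rightarrow> 'a. poly_eval x f = 0 \<and> poly_eval x g = 0 \<and>
          (\<forall>i\<in>{1..n}. poly_eval x (boolean_axiom i) = 0))"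

datatype ips_var = X nat | Y | Z | W nat

definition ips_vars :: "nat \<Rightarrow> ips_var set" where
  "ips_vars n = X ` {1..n} \<union> {Y, Z} \<union> W ` {1..n}"

definition ips_refutation ::
    "nat \<Rightarrow> (nat, 'a::comm_ring_1) mpoly \<Rightarrow> (nat, 'a) mpoly \<Rightarrow> (ips_var, 'a) mpoly \<Rightarrow> bool" where
  "ips_refutation n f g C \<longleftrightarrow>
     C \<in> poly_ring (ips_vars n) \<and>
     subst (\<lambda>v. case v of X i \<Rightarrow> Var i | Y \<Rightarrow> 0 | Z \<Rightarrow> 0 | W i \<Rightarrow> 0) C = (0 :: (nat, 'a) mpoly) \<and>
     subst (\<lambda>v. case v of X i \<Rightarrow> Var i | Y \<Rightarrow> f | Z \<Rightarrow> g | W i \<Rightarrow> boolean_axiom i) C = 1"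

text \<open>A depth-3 powering formula in the variables \<open>V\<close> is the list of its summands \<open>\<ell>\<^sub>i ^ d\<^sub>i\<close>,
  each stored as the pair of \<open>\<ell>\<^sub>i\<close> and \<open>d\<^sub>i\<close>.\<close>

type_synonym ('v, 'a) powering_formula = "(('v, 'a) mpoly \<times> nat) list"

definition is_powering_formula ::
    "'v set \<Rightarrow> ('v, 'a::comm_ring_1) powering_formula \<Rightarrow> bool" where
  "is_powering_formula V F \<longleftrightarrow> (\<forall>(l, d)\<in>set F. affine_linear V l)"

definition formula_poly :: "('v, 'a::comm_ring_1) powering_formula \<Rightarrow> ('v, 'a) mpoly" where
  "formula_poly F = (\<Sum>(l, d)\<leftarrow>F. l ^ d)"

definition formula_size :: "'v set \<Rightarrow> ('v, 'a) powering_formula \<Rightarrow> nat" where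
  "formula_size V F = card V * (\<Sum>(l, d)\<leftarrow>F. d + 1)"

definition sps_ips_refutation ::
    "nat \<Rightarrow> (nat, 'a::comm_ring_1) mpoly \<Rightarrow> (nat, 'a) mpoly \<Rightarrow>
      (ips_var, 'a) powering_formula \<Rightarrow> bool" where
  "sps_ips_refutation n f g F \<longleftrightarrow>
     is_powering_formula (ips_vars n) F \<and> ips_refutation n f g (formula_poly F)"

lemma card_ips_vars: "card (ips_vars n) = 2 * n + 2"
proof -
  have "card (X ` {1..n} \<union> W ` {1..n}) = card (X ` {1..n}) + card (W ` {1..n})"
    by (rule card_Un_disjoint) auto
  also have "\<dots> = 2 * n"
    by (simp add: card_image inj_on_def)
  finally have "card (insert Y (insert Z (X ` {1..n} \<union> W ` {1..n}))) = 2 * n + 2"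
    by (subst card_insert_disjoint; auto)+
  moreover have "ips_vars n = insert Y (insert Z (X ` {1..n} \<union> W ` {1..n}))"
    by (auto simp: ips_vars_def)
  ultimately show ?thesis by simp
qed

end

theory Submission
  imports Defs "HOL-Library.FuncSet"
begin

text \<open>
  Substitute the axioms into \<open>C\<close> but \<open>0\<close> instead of \<open>f\<close>, and let \<open>P = 1 - C(x, 0, g, x\<^sup>2 - x)\<close>.
  Setting any \<open>x\<^sub>j\<close> to \<open>0\<close> kills \<open>f\<close>, hence \<open>P\<close>, so every monomial of \<open>P\<close> contains all the
  variables; and \<open>P\<close> takes the value \<open>1\<close> at the all-ones point, the common zero of \<open>g\<close> and the
  \<open>x\<^sub>i\<^sup>2 - x\<^sub>i\<close>. Apply to \<open>P\<close>, independently for each \<open>j\<close>, one of the operators \<open>x\<^sub>j \<partial>\<^sub>j\<close>,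
  multiplication by \<open>x\<^sub>j\<close>, multiplication by \<open>x\<^sub>j\<^sup>2\<close>. The resulting \<open>3\<^sup>n\<close> polynomials have
  distinct trailing monomials and are therefore linearly independent. On the other hand \<open>P\<close> is
  a combination of \<open>1\<close> and powers \<open>q\<^sup>d\<close> with \<open>q\<close> a sum of univariate quadratic polynomials, so
  \<open>x\<^sub>j \<partial>\<^sub>j q\<close> is a combination of \<open>x\<^sub>j\<close> and \<open>x\<^sub>j\<^sup>2\<close>, and each \<open>q\<^sup>d\<close> is mapped into the
  \<open>(d + 1) 2\<^sup>n\<close>-dimensional span of the \<open>q\<^sup>e x\<^sup>\<upsilon>\<close> with \<open>e \<le> d\<close> and \<open>\<upsilon> \<in> {1, 2}\<^sup>n\<close>. Comparing
  dimensions, \<open>1 + \<Sum>(d\<^sub>i + 1) \<ge> (3/2)\<^sup>n\<close>.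
\<close>

section \<open>Evaluation is a ring homomorphism\<close>

lemma mpoly_eq_sum_single:
  fixes p :: "'k \<Rightarrow>\<^sub>0 'a::comm_monoid_add"
  shows "p = (\<Sum>m\<in>Poly_Mapping.keys p. Poly_Mapping.single m (Poly_Mapping.lookup p m))"
  by (rule poly_mapping_eqI)
    (auto simp: lookup_sum lookup_single when_def in_keys_iff)

text \<open>The case \<open>c = 0\<close> of \<open>single\<close> already provides the base
  \<open>0\<close>, so two cases suffice.\<close>

lemma mpoly_induct [case_names single add]:
  fixes p :: "'k \<Rightarrow>\<^sub>0 'a::comm_monoid_add"
  assumes single: "\<And>m c. Q (Poly_Mapping.single m c)"
    and add: "\<And>p q. Q p \<Longrightarrow> Q q \<Longrightarrow> Q (p + q)"
  shows "Q p"
proof -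
  have "Q 0" using single[of _ 0] by simp
  then have "Q (\<Sum>m\<in>K. Poly_Mapping.single m (Poly_Mapping.lookup p m))" for K
    by (induction K rule: infinite_finite_induct) (auto intro: single add)
  then show ?thesis by (metis mpoly_eq_sum_single)
qed

lemma prod_powers_superset:
  fixes \<sigma> :: "'v \<Rightarrow> 'b::comm_semiring_1"
  assumes "finite K" "Poly_Mapping.keys m \<subseteq> K"
  shows "(\<Prod>v\<in>Poly_Mapping.keys m. \<sigma> v ^ Poly_Mapping.lookup m v) =
    (\<Prod>v\<in>K. \<sigma> v ^ Poly_Mapping.lookup m v)"
  using assms by (intro prod.mono_neutral_left) (auto simp: in_keys_iff)

lemma prod_powers_add:
  fixes \<sigma> :: "'v \<Rightarrow> 'b::comm_semiring_1"
  shows "(\<Prod>v\<in>Poly_Mapping.keys (m + m'). \<sigma> v ^ Poly_Mapping.lookup (m + m') v) =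
    (\<Prod>v\<in>Poly_Mapping.keys m. \<sigma> v ^ Poly_Mapping.lookup m v) *
    (\<Prod>v\<in>Poly_Mapping.keys m'. \<sigma> v ^ Poly_Mapping.lookup m' v)"
proof -
  let ?K = "Poly_Mapping.keys m \<union> Poly_Mapping.keys m'"
  have "Poly_Mapping.keys (m + m') \<subseteq> ?K" by (rule keys_add)
  then have "(\<Prod>v\<in>Poly_Mapping.keys (m + m'). \<sigma> v ^ Poly_Mapping.lookup (m + m') v) =
      (\<Prod>v\<in>?K. \<sigma> v ^ Poly_Mapping.lookup (m + m') v)"
    by (intro prod_powers_superset) auto
  then show ?thesis
    by (simp add: prod_powers_superset[of ?K m] prod_powers_superset[of ?K m']
        lookup_add power_add prod.distrib)
qed

text \<open>Treats two instances at once: the identity on coefficients gives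
  \<open>poly_eval\<close>, and \<open>Const\<close> gives \<open>subst\<close>.\<close>

locale coeff_hom =
  fixes h :: "'a::comm_ring_1 \<Rightarrow> 'b::comm_ring_1"
  assumes h_one: "h 1 = 1"
    and h_add: "h (a + b) = h a + h b"
    and h_mult: "h (a * b) = h a * h b"
begin

lemma h_zero: "h 0 = 0"
  using h_add[of 0 0] by simp

lemma eval_via_single:
  "eval_via h \<sigma> (Poly_Mapping.single m c) =
    h c * (\<Prod>v\<in>Poly_Mapping.keys m. \<sigma> v ^ Poly_Mapping.lookup m v)"
  by (simp add: eval_via_def h_zero)

lemma eval_via_superset:
  assumes "finite K" "Poly_Mapping.keys p \<subseteq> K"
  shows "eval_via h \<sigma> p = (\<Sum>m\<in>K. h (Poly_Mapping.lookup p m) *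
    (\<Prod>v\<in>Poly_Mapping.keys m. \<sigma> v ^ Poly_Mapping.lookup m v))"
  unfolding eval_via_def using assms
  by (intro sum.mono_neutral_left) (auto simp: in_keys_iff h_zero)

lemma eval_via_add: "eval_via h \<sigma> (p + q) = eval_via h \<sigma> p + eval_via h \<sigma> q"
proof -
  let ?K = "Poly_Mapping.keys p \<union> Poly_Mapping.keys q"
  have "Poly_Mapping.keys (p + q) \<subseteq> ?K" by (rule keys_add)
  then show ?thesis
    by (simp add: eval_via_superset[of ?K] lookup_add h_add algebra_simps sum.distrib)
qed

lemma eval_via_zero: "eval_via h \<sigma> 0 = 0"
  by (simp add: eval_via_def)

lemma eval_via_one: "eval_via h \<sigma> 1 = 1"
  by (simp add: eval_via_def h_one)

lemma eval_via_diff: "eval_via h \<sigma> (p - q) = eval_via h \<sigma> p - eval_via h \<sigma> q"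
  using eval_via_add[of \<sigma> "p - q" q] by simp

lemma eval_via_mult: "eval_via h \<sigma> (p * q) = eval_via h \<sigma> p * eval_via h \<sigma> q"
proof (induction p rule: mpoly_induct)
  case (single m c)
  show ?case
  proof (induction q rule: mpoly_induct)
    case (single m' c')
    then show ?case
      by (simp add: mult_single eval_via_single h_mult prod_powers_add algebra_simps)
  qed (simp add: eval_via_add algebra_simps)
qed (simp add: eval_via_add algebra_simps)

lemma eval_via_power: "eval_via h \<sigma> (p ^ d) = eval_via h \<sigma> p ^ d"
  by (induction d) (simp_all add: eval_via_one eval_via_mult)

lemma eval_via_sum: "eval_via h \<sigma> (\<Sum>i\<in>I. p i) = (\<Sum>i\<in>I. eval_via h \<sigma> (p i))"
  by (induction I rule: infinite_finite_induct) (simp_all add: eval_via_zero eval_via_add)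

lemma eval_via_prod: "eval_via h \<sigma> (\<Prod>i\<in>I. p i) = (\<Prod>i\<in>I. eval_via h \<sigma> (p i))"
  by (induction I rule: infinite_finite_induct) (simp_all add: eval_via_one eval_via_mult)

lemma eval_via_sum_list: "eval_via h \<sigma> (\<Sum>i\<leftarrow>I. p i) = (\<Sum>i\<leftarrow>I. eval_via h \<sigma> (p i))"
  by (induction I) (simp_all add: eval_via_zero eval_via_add)

lemmas eval_via_hom = eval_via_zero eval_via_one eval_via_add eval_via_diff eval_via_mult
  eval_via_power eval_via_sum eval_via_prod eval_via_sum_list

end

section \<open>Constants as a subring, and composition of substitutions\<close>

lemma Const_zero: "Const 0 = 0"
  by (simp add: Const_def)

lemma Const_one: "Const 1 = 1"
  by (simp add: Const_def)

lemma Const_add: "Const (a + b) = Const a + Const b"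
  by (simp add: Const_def single_add)

lemma Const_mult: "Const (a * b) = Const a * (Const b :: ('v, 'a::comm_semiring_1) mpoly)"
  by (simp add: Const_def mult_single)

lemma Const_prod: "Const (\<Prod>i\<in>I. a i) = (\<Prod>i\<in>I. Const (a i) :: ('v, 'a::comm_semiring_1) mpoly)"
  by (induction I rule: infinite_finite_induct) (simp_all add: Const_one Const_mult)

interpretation id_hom: coeff_hom "\<lambda>c. c :: 'a::comm_ring_1"
  by standard auto

interpretation Const_hom: coeff_hom "Const :: 'a::comm_ring_1 \<Rightarrow> ('w, 'a) mpoly"
  by standard (simp_all add: Const_one Const_add Const_mult)

lemmas poly_eval_hom = id_hom.eval_via_hom[folded poly_eval_def] poly_eval_Var poly_eval_Const
lemmas subst_hom = Const_hom.eval_via_hom[folded subst_def] subst_Var subst_Const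

lemma lookup_Const_mult:
  fixes p :: "('v, 'a::comm_semiring_1) mpoly"
  shows "Poly_Mapping.lookup (Const c * p) m = c * Poly_Mapping.lookup p m"
  by (simp add: Const_def mult_map_scale_conv_mult[symmetric] Poly_Mapping.map.rep_eq when_def)

lemma subst_comp:
  fixes p :: "('u, 'a::comm_ring_1) mpoly"
  shows "subst \<tau> (subst \<sigma> p) = subst (\<lambda>v. subst \<tau> (\<sigma> v)) p"
proof -
  have "subst \<tau> (eval_via Const \<sigma> p) = eval_via Const (\<lambda>v. subst \<tau> (\<sigma> v)) p"
    by (simp add: eval_via_def subst_hom)
  then show ?thesis by (simp add: subst_def)
qed

lemma poly_eval_subst:
  fixes p :: "('u, 'a::comm_ring_1) mpoly"
  shows "poly_eval x (subst \<sigma> p) = poly_eval (\<lambda>v. poly_eval x (\<sigma> v)) p"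
proof -
  have "poly_eval x (eval_via Const \<sigma> p) = eval_via (\<lambda>c. c) (\<lambda>v. poly_eval x (\<sigma> v)) p"
    by (simp add: eval_via_def poly_eval_hom)
  then show ?thesis by (simp add: subst_def poly_eval_def)
qed

section \<open>Euler operators\<close>

text \<open>For finite \<open>S\<close>, the composite of the commuting operators x_j d/dx_j with j
  in \<open>S\<close>. Every monomial is an eigenvector, hence the coefficientwise encoding.\<close>

definition euler :: "'v set \<Rightarrow> ('v, 'a::comm_ring_1) mpoly \<Rightarrow> ('v, 'a) mpoly" where
  "euler S = Poly_Mapping.mapp (\<lambda>m c. of_nat (\<Prod>j\<in>S. Poly_Mapping.lookup m j) * c)"

lemma lookup_euler:
  "Poly_Mapping.lookup (euler S p) m =
    of_nat (\<Prod>j\<in>S. Poly_Mapping.lookup m j) * Poly_Mapping.lookup p m"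
  by (simp add: euler_def lookup_mapp when_def in_keys_iff)

lemma euler_empty [simp]: "euler {} p = p"
  by (rule poly_mapping_eqI) (simp add: lookup_euler)

lemma euler_insert: "finite S \<Longrightarrow> j \<notin> S \<Longrightarrow> euler (insert j S) p = euler {j} (euler S p)"
  by (rule poly_mapping_eqI) (simp add: lookup_euler algebra_simps)

lemma euler_add: "euler S (p + q) = euler S p + euler S q"
  by (rule poly_mapping_eqI) (simp add: lookup_euler lookup_add algebra_simps)

lemma euler_zero [simp]: "euler S 0 = 0"
  by (rule poly_mapping_eqI) (simp add: lookup_euler)

lemma euler_Const_mult: "euler S (Const c * p) = Const c * euler S p"
  by (rule poly_mapping_eqI) (simp add: lookup_euler lookup_Const_mult mult.left_commute del: of_nat_prod)

lemma euler_single: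
  "euler {j} (Poly_Mapping.single m c) =
    Poly_Mapping.single m (of_nat (Poly_Mapping.lookup m j) * c)"
  by (rule poly_mapping_eqI) (auto simp: lookup_euler lookup_single when_def)

lemma euler_Const [simp]: "euler {j} (Const c) = 0"
  by (simp add: Const_def euler_single)

lemma euler_Var: "euler {j} (Var i) = (if i = j then Var i else 0)"
  by (simp add: Var_def euler_single lookup_single when_def)

text \<open>The Leibniz rule. By bilinearity it reduces to a product of two monomials, where it says
  that the exponents of x_j add up.\<close>

lemma euler_mult: "euler {j} (p * q) = euler {j} p * q + p * euler {j} q"
proof (induction p rule: mpoly_induct)
  case (single m c)
  show ?case
  proof (induction q rule: mpoly_induct)
    case (single m' c')
    show ?case
      by (simp add: euler_single mult_single lookup_add single_add[symmetric] algebra_simps)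
  qed (simp add: euler_add algebra_simps)
qed (simp add: euler_add algebra_simps)

lemma euler_of_nat [simp]: "euler {j} (of_nat k) = 0"
  by (metis Const_def euler_Const single_of_nat)

lemma euler_one [simp]: "euler {j} 1 = 0"
  using euler_of_nat[of j 1] by simp

text \<open>The chain rule for powers. At \<open>d = 0\<close> the truncated exponent
  \<open>d - 1\<close> is harmless, since the factor \<open>of_nat d\<close> vanishes.\<close>

lemma euler_power: "euler {j} (q ^ d) = of_nat d * q ^ (d - 1) * euler {j} q"
proof (induction d)
  case (Suc d)
  then show ?case by (cases d) (simp_all add: euler_mult algebra_simps)
qed simp

lemma euler_prod_eq_0:
  assumes "\<And>i. i \<in> S \<Longrightarrow> euler {j} (u i) = 0"
  shows "euler {j} (\<Prod>i\<in>S. u i) = 0"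
  using assms by (induction S rule: infinite_finite_induct) (simp_all add: euler_mult)

text \<open>The integer \<open>c\<close> is the falling factorial of \<open>d\<close> of length \<open>card S\<close>.\<close>

lemma euler_power_separable:
  assumes "finite S" and "\<And>i j. i \<in> S \<Longrightarrow> j \<in> S \<Longrightarrow> i \<noteq> j \<Longrightarrow> euler {j} (euler {i} q) = 0"
  shows "\<exists>c. euler S (q ^ d) = of_nat c * q ^ (d - card S) * (\<Prod>j\<in>S. euler {j} q)"
  using assms
proof (induction S)
  case empty
  then show ?case by (intro exI[of _ 1]) simp
next
  case (insert j S)
  then obtain c where c: "euler S (q ^ d) = of_nat c * q ^ (d - card S) * (\<Prod>i\<in>S. euler {i} q)"
    by blast
  \<comment> \<open>Mixed derivatives of \<open>q\<close> vanish, so the Leibniz rule leaves only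
    the term in which the power of \<open>q\<close> is differentiated.\<close>
  have zero: "euler {j} (\<Prod>i\<in>S. euler {i} q) = 0"
  proof (rule euler_prod_eq_0)
    fix i assume "i \<in> S"
    then show "euler {j} (euler {i} q) = 0"
      using insert.hyps(2) by (intro insert.prems) auto
  qed
  have "euler (insert j S) (q ^ d) = euler {j} (of_nat c * q ^ (d - card S) * (\<Prod>i\<in>S. euler {i} q))"
    by (simp only: euler_insert[OF insert.hyps] c)
  also have "\<dots> = of_nat c * (of_nat (d - card S) * q ^ (d - card S - 1) * euler {j} q) *
      (\<Prod>i\<in>S. euler {i} q)"
    by (simp add: euler_mult zero euler_power del: of_nat_diff)
  \<comment> \<open>If \<open>d \<le> card S\<close>, the exponent is truncated to 0, but then the
    new coefficient \<open>d - card S\<close> is 0 as well.\<close>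
  also have "d - card S - 1 = d - card (insert j S)"
    using insert.hyps by simp
  also have "of_nat c * (of_nat (d - card S) * q ^ (d - card (insert j S)) * euler {j} q) *
      (\<Prod>i\<in>S. euler {i} q) = of_nat (c * (d - card S)) * q ^ (d - card (insert j S)) *
      (\<Prod>i\<in>insert j S. euler {i} q)"
    by (simp only: of_nat_mult prod.insert insert.hyps mult.assoc not_False_eq_True)
  finally show ?case by blast
qed

section \<open>Linear independence and trailing monomials\<close>

definition mpoly_scale :: "'a \<Rightarrow> ('v, 'a::field) mpoly \<Rightarrow> ('v, 'a) mpoly" where
  "mpoly_scale c p = Const c * p"

interpretation mpoly: vector_space "mpoly_scale :: 'a::field \<Rightarrow> ('v, 'a) mpoly \<Rightarrow> _"
  by standard (simp_all add: mpoly_scale_def Const_add Const_mult Const_one algebra_simps)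

text \<open>The least exponent vector in the order on finitely supported maps, which is compatible
  with addition. Meaningful only for nonzero \<open>p\<close>.\<close>

definition trailing :: "('v::linorder, 'a::zero) mpoly \<Rightarrow> 'v \<Rightarrow>\<^sub>0 nat" where
  "trailing p = Min (Poly_Mapping.keys p)"

lemma trailing_in_keys: "p \<noteq> 0 \<Longrightarrow> trailing p \<in> Poly_Mapping.keys p"
  unfolding trailing_def by (rule Min_in) (auto simp: keys_eq_empty poly_mapping_eq_iff fun_eq_iff)

lemma lookup_less_trailing: "m < trailing p \<Longrightarrow> Poly_Mapping.lookup p m = 0"
  unfolding trailing_def by (metis Min_le finite_keys in_keys_iff leD)

text \<open>Among the members with nonzero coefficient take the one, \<open>r\<close>, with the
  least trailing monomial. This monomial occurs in no other such member, so it cannot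
  cancel.\<close>

lemma independent_distinct_trailing:
  fixes B :: "('v::linorder, 'a::field) mpoly set"
  assumes B: "finite B" "0 \<notin> B" and inj: "inj_on trailing B"
  shows "mpoly.independent B"
proof (rule mpoly.independent_if_scalars_zero[OF B(1)], rule ccontr)
  fix f p
  assume sum0: "(\<Sum>q\<in>B. mpoly_scale (f q) q) = 0" and p: "p \<in> B" "f p \<noteq> 0"
  let ?N = "{q\<in>B. f q \<noteq> 0}"
  have "finite ?N" "?N \<noteq> {}" using B p by auto
  then obtain r where r: "r \<in> ?N" "\<And>q. q \<in> ?N \<Longrightarrow> trailing r \<le> trailing q"
    by (metis (no_types, lifting) arg_min_if_finite(1) arg_min_least)
  have other: "f q * Poly_Mapping.lookup q (trailing r) = 0" if "q \<in> B - {r}" for q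
  proof (cases "f q = 0")
    case False
    with that r inj have "trailing r < trailing q"
      by (metis (mono_tags, lifting) DiffE inj_onD insertI1 mem_Collect_eq order_le_imp_less_or_eq)
    then show ?thesis by (simp add: lookup_less_trailing)
  qed simp
  have "0 = (\<Sum>q\<in>B. f q * Poly_Mapping.lookup q (trailing r))"
    using arg_cong[OF sum0, of "\<lambda>p. Poly_Mapping.lookup p (trailing r)"]
    by (simp add: lookup_sum mpoly_scale_def lookup_Const_mult)
  also have "\<dots> = f r * Poly_Mapping.lookup r (trailing r) +
      (\<Sum>q\<in>B - {r}. f q * Poly_Mapping.lookup q (trailing r))"
    using B(1) r(1) by (intro sum.remove) auto
  also have "(\<Sum>q\<in>B - {r}. f q * Poly_Mapping.lookup q (trailing r)) = 0"
    using other by (rule sum.neutral[OF ballI])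
  finally show False
    using r B trailing_in_keys[of r] by (auto simp: in_keys_iff)
qed

section \<open>Effect of monomial multiplication and Euler operators on supports\<close>

lemma lookup_single_mult:
  fixes p :: "('v, 'a::comm_semiring_1) mpoly"
  shows "Poly_Mapping.lookup (Poly_Mapping.single b 1 * p) (b + m) = Poly_Mapping.lookup p m"
proof (induction p rule: mpoly_induct)
  case (single m' c)
  then show ?case by (simp add: mult_single lookup_single when_def)
qed (simp add: lookup_add algebra_simps)

lemma keys_single_mult:
  fixes p :: "('v, 'a::comm_semiring_1) mpoly"
  shows "Poly_Mapping.keys (Poly_Mapping.single b 1 * p) = (+) b ` Poly_Mapping.keys p"
proof
  have "Poly_Mapping.keys (Poly_Mapping.single b (1::'a) * p)
      \<subseteq> {x + y |x y. x \<in> Poly_Mapping.keys (Poly_Mapping.single b (1::'a)) \<and> y \<in> Poly_Mapping.keys p}"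
    by (rule keys_mult)
  then show "Poly_Mapping.keys (Poly_Mapping.single b 1 * p) \<subseteq> (+) b ` Poly_Mapping.keys p"
    by auto
  show "(+) b ` Poly_Mapping.keys p \<subseteq> Poly_Mapping.keys (Poly_Mapping.single b 1 * p)"
    by (auto simp: in_keys_iff lookup_single_mult)
qed

text \<open>Adding \<open>b\<close> preserves the order of exponent vectors, so it commutes with
  taking the minimum.\<close>

lemma trailing_single_mult:
  fixes p :: "('v::linorder, 'a::comm_semiring_1) mpoly"
  assumes "p \<noteq> 0"
  shows "trailing (Poly_Mapping.single b 1 * p) = b + trailing p"
  unfolding trailing_def keys_single_mult
  by (rule mono_Min_commute[symmetric])
    (use trailing_in_keys[OF assms] in \<open>auto simp: mono_def add_left_mono\<close>)

text \<open>Each monomial is scaled by a product of positive exponents, which stays nonzero in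
  characteristic 0, so no term is lost.\<close>

lemma keys_euler:
  fixes p :: "('v, 'a::{comm_ring_1,semiring_char_0,semiring_no_zero_divisors}) mpoly"
  assumes "finite S" "\<And>m. m \<in> Poly_Mapping.keys p \<Longrightarrow> S \<subseteq> Poly_Mapping.keys m"
  shows "Poly_Mapping.keys (euler S p) = Poly_Mapping.keys p"
proof (rule set_eqI)
  fix m
  have "(\<Prod>j\<in>S. Poly_Mapping.lookup m j) \<noteq> 0" if "m \<in> Poly_Mapping.keys p"
    using assms(1) assms(2)[OF that] by (auto simp: in_keys_iff)
  then show "m \<in> Poly_Mapping.keys (euler S p) \<longleftrightarrow> m \<in> Poly_Mapping.keys p"
    by (auto simp: in_keys_iff lookup_euler simp del: of_nat_prod)
qed

section \<open>Sums of powers of separable quadratic polynomials\<close>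

lemma Var_power:
  "(Var i :: ('v, 'a::comm_semiring_1) mpoly) ^ e = Poly_Mapping.single (Poly_Mapping.single i e) 1"
  by (induction e) (simp_all add: Var_def mult_single single_add[symmetric])

definition monomial_on :: "'v set \<Rightarrow> ('v \<Rightarrow> nat) \<Rightarrow> ('v, 'a::comm_ring_1) mpoly" where
  "monomial_on I \<tau> = (\<Prod>j\<in>I. Var j ^ \<tau> j)"

lemma monomial_on_eq_single:
  "monomial_on I \<tau> = Poly_Mapping.single (\<Sum>j\<in>I. Poly_Mapping.single j (\<tau> j)) 1"
  unfolding monomial_on_def
  by (induction I rule: infinite_finite_induct) (simp_all add: mult_single Var_power)

text \<open>Over a field of characteristic 0 this describes sums of univariate polynomials of degree
  at most 2 in the variables from \<open>I\<close>, plus a part free of these variables. It is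
  phrased by derivatives because only they enter the span argument.\<close>

definition separable_quadratic_on :: "'v set \<Rightarrow> ('v, 'a::comm_ring_1) mpoly \<Rightarrow> bool" where
  "separable_quadratic_on I q \<longleftrightarrow>
    (\<forall>j\<in>I. \<exists>a b. euler {j} q = Const a * Var j + Const b * (Var j)\<^sup>2)"

text \<open>Expanding the product means choosing exponent 1 or 2 for each variable; the choices are
  the functions in \<open>I \<rightarrow>\<^sub>E {1, 2}\<close>.\<close>

lemma prod_separable_in_span:
  fixes y :: "'v \<Rightarrow> ('v, 'a::field) mpoly"
  assumes "finite I" and y: "\<And>j. j \<in> I \<Longrightarrow> \<exists>a b. y j = Const a * Var j + Const b * (Var j)\<^sup>2"
  shows "(\<Prod>j\<in>I. y j) \<in> mpoly.span (monomial_on I ` (I \<rightarrow>\<^sub>E {1, 2}))"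
proof -
  obtain a b where "\<And>j. j \<in> I \<Longrightarrow> y j = Const (a j) * Var j + Const (b j) * (Var j)\<^sup>2"
    using y by metis
  then have "y j = (\<Sum>e\<in>{1, 2}. Const (if e = 1 then a j else b j) * Var j ^ e)" if "j \<in> I" for j
    using that by simp
  then have "(\<Prod>j\<in>I. y j) =
      (\<Prod>j\<in>I. \<Sum>e\<in>{1, 2}. Const (if e = 1 then a j else b j) * Var j ^ e)"
    by (intro prod.cong) auto
  also have "\<dots> = (\<Sum>\<upsilon>\<in>I \<rightarrow>\<^sub>E {1, 2}.
      \<Prod>j\<in>I. Const (if \<upsilon> j = 1 then a j else b j) * Var j ^ \<upsilon> j)"
    using assms(1) by (intro prod_sum_PiE) auto
  also have "\<dots> = (\<Sum>\<upsilon>\<in>I \<rightarrow>\<^sub>E {1, 2}.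
      mpoly_scale (\<Prod>j\<in>I. if \<upsilon> j = 1 then a j else b j) (monomial_on I \<upsilon>))"
    by (simp add: mpoly_scale_def Const_prod monomial_on_def prod.distrib)
  finally show ?thesis
    by (auto intro!: mpoly.span_sum mpoly.span_scale intro: mpoly.span_base)
qed

lemma card_UN_list: "card (\<Union>x\<in>set xs. A x) \<le> (\<Sum>x\<leftarrow>xs. card (A x))"
proof (induction xs)
  case (Cons x xs)
  then show ?case using card_Un_le[of "A x" "\<Union>x\<in>set xs. A x"] by simp
qed simp

text \<open>The value \<open>\<tau> j\<close> selects the operator for x_j: 0 stands for x_j d/dx_j,
  and 1 or 2 for multiplication by that power of x_j.\<close>

definition shift_euler :: "'v set \<Rightarrow> ('v \<Rightarrow> nat) \<Rightarrow> ('v, 'a::comm_ring_1) mpoly \<Rightarrow> ('v, 'a) mpoly" where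
  "shift_euler I \<tau> p = monomial_on I \<tau> * euler {j\<in>I. \<tau> j = 0} p"

text \<open>Differentiation lowers the power of \<open>q\<close> and splits off factors
  \<open>euler {j} q\<close>. Like the multipliers x_j and x_j squared, these are combinations of
  x_j and x_j squared, so every variable contributes only two dimensions.\<close>

lemma shift_euler_power_in_span:
  fixes q :: "('v, 'a::field) mpoly"
  assumes I: "finite I" and \<tau>: "\<tau> \<in> I \<rightarrow>\<^sub>E {0, 1, 2}" and q: "separable_quadratic_on I q"
  shows "shift_euler I \<tau> (q ^ d) \<in>
    mpoly.span ((\<lambda>(e, \<upsilon>). q ^ e * monomial_on I \<upsilon>) ` ({..d} \<times> (I \<rightarrow>\<^sub>E {1, 2})))"
proof -
  let ?S = "{j\<in>I. \<tau> j = 0}"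
  \<comment> \<open>The factor that x_j contributes once the operator selected by
    \<open>\<tau> j\<close> has acted on the power of \<open>q\<close>.\<close>
  let ?y = "\<lambda>j. if \<tau> j = 0 then euler {j} q else Var j ^ \<tau> j"
  have fin: "finite ?S" using I by simp
  have "euler {j} (euler {i} q) = 0" if "i \<in> ?S" "j \<in> ?S" "i \<noteq> j" for i j
  proof -
    obtain a b where "euler {i} q = Const a * Var i + Const b * (Var i)\<^sup>2"
      using q \<open>i \<in> ?S\<close> unfolding separable_quadratic_on_def by blast
    then show ?thesis
      using \<open>i \<noteq> j\<close> by (simp add: euler_add euler_Const_mult euler_power euler_Var)
  qed
  from euler_power_separable[OF fin this] obtain c where c:
    "euler ?S (q ^ d) = of_nat c * q ^ (d - card ?S) * (\<Prod>j\<in>?S. euler {j} q)"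
    by blast
  have prod_y: "monomial_on I \<tau> * (\<Prod>j\<in>?S. euler {j} q) = (\<Prod>j\<in>I. ?y j)"
  proof -
    have "(\<Prod>j\<in>?S. euler {j} q) = (\<Prod>j\<in>I. if \<tau> j = 0 then euler {j} q else 1)"
      using I by (simp add: prod.inter_filter)
    then have "monomial_on I \<tau> * (\<Prod>j\<in>?S. euler {j} q) =
        (\<Prod>j\<in>I. Var j ^ \<tau> j * (if \<tau> j = 0 then euler {j} q else 1))"
      by (simp only: monomial_on_def prod.distrib)
    also have "\<dots> = (\<Prod>j\<in>I. ?y j)"
      by (intro prod.cong) auto
    finally show ?thesis .
  qed
  have eq: "shift_euler I \<tau> (q ^ d) =
      mpoly_scale (of_nat c) (q ^ (d - card ?S) * (\<Prod>j\<in>I. ?y j))"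
    unfolding shift_euler_def mpoly_scale_def Const_def single_of_nat c prod_y[symmetric]
    by (simp only: mult_ac)
  have "\<exists>a b. ?y j = Const a * Var j + Const b * (Var j)\<^sup>2" if "j \<in> I" for j
  proof -
    have "\<tau> j \<in> {0, 1, 2}" using \<tau> that by (rule PiE_mem)
    then consider "\<tau> j = 0" | "\<tau> j = 1" | "\<tau> j = 2" by auto
    then show ?thesis
    proof cases
      case 1
      then show ?thesis using q that by (simp add: separable_quadratic_on_def)
    next
      case 2
      then show ?thesis by (intro exI[of _ 1] exI[of _ 0]) (simp add: Const_zero Const_one)
    next
      case 3
      then show ?thesis by (intro exI[of _ 0] exI[of _ 1]) (simp add: Const_zero Const_one)
    qed
  qed
  then have y: "(\<Prod>j\<in>I. ?y j) \<in> mpoly.span (monomial_on I ` (I \<rightarrow>\<^sub>E {1, 2}))"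
    by (rule prod_separable_in_span[OF I])
  \<comment> \<open>Multiplication by \<open>q ^ e\<close> is linear, so only its effect on the
    generators \<open>monomial_on I \<upsilon>\<close> matters.\<close>
  have "q ^ e * z \<in>
      mpoly.span ((\<lambda>(e, \<upsilon>). q ^ e * monomial_on I \<upsilon>) ` ({..d} \<times> (I \<rightarrow>\<^sub>E {1, 2})))"
    if "e \<le> d" "z \<in> mpoly.span (monomial_on I ` (I \<rightarrow>\<^sub>E {1, 2}))" for e z
    using that(2)
  proof (induction rule: mpoly.span_induct_alt)
    case base
    then show ?case by (simp add: mpoly.span_zero)
  next
    case (step c x y)
    have "q ^ e * (mpoly_scale c x + y) = mpoly_scale c (q ^ e * x) + q ^ e * y"
      by (simp add: mpoly_scale_def algebra_simps)
    moreover have "q ^ e * x \<in>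
        mpoly.span ((\<lambda>(e, \<upsilon>). q ^ e * monomial_on I \<upsilon>) ` ({..d} \<times> (I \<rightarrow>\<^sub>E {1, 2})))"
      using step(1) that(1) by (intro mpoly.span_base) auto
    ultimately show ?case
      using step by (simp add: mpoly.span_add mpoly.span_scale)
  qed
  from this[OF _ y] show ?thesis
    unfolding eq by (intro mpoly.span_scale) simp
qed

text \<open>The images of \<open>P\<close> under all operators form an independent set
  \<open>B\<close>, whose size is the left side. It lies in the span of \<open>A\<close>, whose size
  is at most the right side.\<close>

lemma sum_of_powers_lower_bound:
  fixes P :: "('v::linorder, 'a::field_char_0) mpoly"
  assumes I: "finite I" and P: "P \<noteq> 0"
    and keys: "\<And>m. m \<in> Poly_Mapping.keys P \<Longrightarrow> I \<subseteq> Poly_Mapping.keys m"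
    and span: "P \<in> mpoly.span ((\<lambda>(q, d). q ^ d) ` set L)"
    and L: "\<And>q d. (q, d) \<in> set L \<Longrightarrow> separable_quadratic_on I q"
  shows "3 ^ card I \<le> (\<Sum>(q, d)\<leftarrow>L. d + 1) * 2 ^ card I"
proof -
  let ?T = "I \<rightarrow>\<^sub>E {0, 1, 2::nat}"
  define G where
    "G = (\<lambda>(q, d). (\<lambda>(e, \<upsilon>). q ^ e * monomial_on I \<upsilon> :: ('v, 'a) mpoly) ` ({..d} \<times> (I \<rightarrow>\<^sub>E {1, 2})))"
  define A where "A = (\<Union>x\<in>set L. G x)"
  define B where "B = (\<lambda>\<tau>. shift_euler I \<tau> P) ` ?T"
  have finG: "finite (G x)" and cardG: "card (G x) \<le> (case x of (q, d) \<Rightarrow> d + 1) * 2 ^ card I" for x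
  proof -
    obtain q d where x: "x = (q, d)" by fastforce
    have fin: "finite ({..d} \<times> (I \<rightarrow>\<^sub>E {1, 2::nat}))" using I by (simp add: finite_PiE)
    then show "finite (G x)" by (simp add: G_def x)
    show "card (G x) \<le> (case x of (q, d) \<Rightarrow> d + 1) * 2 ^ card I"
      using card_image_le[OF fin, of "\<lambda>(e, \<upsilon>). q ^ e * monomial_on I \<upsilon>"] I
      by (simp add: G_def x card_cartesian_product card_PiE flip: numeral_2_eq_2)
  qed
  have finA: "finite A" unfolding A_def using finG by blast
  have "card A \<le> (\<Sum>x\<leftarrow>L. card (G x))"
    unfolding A_def by (rule card_UN_list)
  also have "\<dots> \<le> (\<Sum>x\<leftarrow>L. (case x of (q, d) \<Rightarrow> d + 1) * 2 ^ card I)"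
    by (rule sum_list_mono) (rule cardG)
  also have "\<dots> = (\<Sum>(q, d)\<leftarrow>L. d + 1) * 2 ^ card I"
    by (simp add: sum_list_mult_const)
  finally have cardA: "card A \<le> (\<Sum>(q, d)\<leftarrow>L. d + 1) * 2 ^ card I" .

  \<comment> \<open>Every monomial of \<open>P\<close> contains all variables from \<open>I\<close>,
    so the Euler operators do not move its trailing monomial.\<close>
  have keys_eq: "Poly_Mapping.keys (euler {j\<in>I. \<tau> j = 0} P) = Poly_Mapping.keys P"
    for \<tau> :: "'v \<Rightarrow> nat"
    using I keys by (intro keys_euler) auto
  have nonzero: "euler {j\<in>I. \<tau> j = 0} P \<noteq> 0" for \<tau> :: "'v \<Rightarrow> nat"
    using keys_eq[of \<tau>] trailing_in_keys[OF P] by auto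
  have trail: "trailing (shift_euler I \<tau> P) =
      (\<Sum>j\<in>I. Poly_Mapping.single j (\<tau> j)) + trailing P" for \<tau>
  proof -
    have "trailing (euler {j\<in>I. \<tau> j = 0} P) = trailing P"
      by (simp add: trailing_def keys_eq)
    then show ?thesis
      by (simp add: shift_euler_def monomial_on_eq_single trailing_single_mult nonzero)
  qed
  have shift_nonzero: "shift_euler I \<tau> P \<noteq> 0" for \<tau>
  proof -
    have "Poly_Mapping.keys (shift_euler I \<tau> P) \<noteq> {}"
      using trailing_in_keys[OF P]
      by (auto simp: shift_euler_def monomial_on_eq_single keys_single_mult keys_eq)
    then show ?thesis by auto
  qed
  \<comment> \<open>The trailing monomial of \<open>P\<close> is shifted by \<open>\<tau>\<close>,
    which can thus be read off on \<open>I\<close>; outside \<open>I\<close> it is fixed by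
    extensionality.\<close>
  have inj: "inj_on (\<lambda>\<tau>. trailing (shift_euler I \<tau> P)) ?T"
  proof (rule inj_onI)
    fix \<tau> \<tau>' assume \<tau>: "\<tau> \<in> ?T" "\<tau>' \<in> ?T"
      and "trailing (shift_euler I \<tau> P) = trailing (shift_euler I \<tau>' P)"
    then have eq: "(\<Sum>j\<in>I. Poly_Mapping.single j (\<tau> j)) = (\<Sum>j\<in>I. Poly_Mapping.single j (\<tau>' j))"
      by (simp add: trail)
    have "\<tau> i = \<tau>' i" if "i \<in> I" for i
      using arg_cong[OF eq, of "\<lambda>m. Poly_Mapping.lookup m i"] I that
      by (simp add: lookup_sum lookup_single when_def)
    then show "\<tau> = \<tau>'" using \<tau> by (intro PiE_ext) auto
  qed
  \<comment> \<open>Distinct trailing monomials make the images distinct, so none is lost in forming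
    the set \<open>B\<close>.\<close>
  have "inj_on (\<lambda>\<tau>. shift_euler I \<tau> P) ?T"
    using inj by (auto simp: inj_on_def)
  then have "card B = 3 ^ card I"
    unfolding B_def using I by (simp add: card_image card_PiE flip: numeral_3_eq_3)
  moreover have "mpoly.independent B"
  proof (rule independent_distinct_trailing)
    show "finite B" unfolding B_def using I by (simp add: finite_PiE)
    show "0 \<notin> B" unfolding B_def using shift_nonzero by auto
    show "inj_on trailing B" unfolding B_def using inj by (auto simp: inj_on_def)
  qed
  moreover have "B \<subseteq> mpoly.span A"
  proof -
    have "shift_euler I \<tau> P \<in> mpoly.span A" if \<tau>: "\<tau> \<in> ?T" for \<tau>
      using span
    proof (induction rule: mpoly.span_induct_alt)
      case base
      then show ?case by (simp add: shift_euler_def mpoly.span_zero)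
    next
      case (step c x y)
      then obtain q d where x: "x = q ^ d" "(q, d) \<in> set L" by auto
      have "shift_euler I \<tau> x \<in> mpoly.span (G (q, d))"
        using shift_euler_power_in_span[OF I \<tau> L[OF x(2)], of d] by (simp add: G_def x)
      moreover have "mpoly.span (G (q, d)) \<subseteq> mpoly.span A"
        unfolding A_def using x by (intro mpoly.span_mono) auto
      moreover have "shift_euler I \<tau> (mpoly_scale c x + y) =
          mpoly_scale c (shift_euler I \<tau> x) + shift_euler I \<tau> y"
        by (simp add: shift_euler_def mpoly_scale_def euler_add euler_Const_mult distrib_left mult.left_commute)
      ultimately show ?case
        using step by (auto intro: mpoly.span_add mpoly.span_scale)
    qed
    then show ?thesis by (auto simp: B_def)
  qed
  ultimately have "3 ^ card I \<le> card A"
    using mpoly.independent_span_bound[OF finA] by metis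
  then show ?thesis using cardA by (rule le_trans)
qed

section \<open>The refutation\<close>

text \<open>Setting x_j to 0 deletes the monomials that contain x_j and keeps all others with their
  coefficients, so nothing can cancel.\<close>

lemma keys_if_subst_zero:
  fixes p :: "('v, 'a::comm_ring_1) mpoly"
  assumes p: "subst (\<lambda>i. if i = j then 0 else Var i) p = 0" and m: "m \<in> Poly_Mapping.keys p"
  shows "j \<in> Poly_Mapping.keys m"
proof (rule ccontr)
  assume j: "j \<notin> Poly_Mapping.keys m"
  let ?\<sigma> = "\<lambda>i. if i = j then 0 else Var i :: ('v, 'a) mpoly"
  have val: "(\<Prod>v\<in>Poly_Mapping.keys k. ?\<sigma> v ^ Poly_Mapping.lookup k v) =
      Poly_Mapping.single k (if j \<in> Poly_Mapping.keys k then 0 else 1)" for k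
  proof (cases "j \<in> Poly_Mapping.keys k")
    case True
    then show ?thesis by (auto simp: in_keys_iff zero_power intro!: prod_zero bexI[of _ j])
  next
    case False
    then have "(\<Prod>v\<in>Poly_Mapping.keys k. ?\<sigma> v ^ Poly_Mapping.lookup k v) =
        monomial_on (Poly_Mapping.keys k) (Poly_Mapping.lookup k)"
      unfolding monomial_on_def by (intro prod.cong) auto
    then show ?thesis
      using False by (simp add: monomial_on_eq_single mpoly_eq_sum_single[symmetric])
  qed
  have "subst ?\<sigma> p = (\<Sum>k\<in>Poly_Mapping.keys p.
      Poly_Mapping.single k (if j \<in> Poly_Mapping.keys k then 0 else Poly_Mapping.lookup p k))"
    unfolding subst_def eval_via_def val
    by (intro sum.cong) (auto simp: Const_def mult_single)
  then have "Poly_Mapping.lookup (subst ?\<sigma> p) m = Poly_Mapping.lookup p m"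
    using j m by (simp add: lookup_sum lookup_single when_def)
  then show False using p m by (simp add: in_keys_iff)
qed

section \<open>Closure properties of separable quadratic polynomials\<close>

lemma separable_quadratic_on_add:
  assumes "separable_quadratic_on I p" "separable_quadratic_on I q"
  shows "separable_quadratic_on I (p + q)"
  unfolding separable_quadratic_on_def
proof
  fix j assume "j \<in> I"
  then obtain a b a' b' where "euler {j} p = Const a * Var j + Const b * (Var j)\<^sup>2"
    and "euler {j} q = Const a' * Var j + Const b' * (Var j)\<^sup>2"
    using assms unfolding separable_quadratic_on_def by metis
  then have "euler {j} (p + q) = Const (a + a') * Var j + Const (b + b') * (Var j)\<^sup>2"
    by (simp add: euler_add Const_add algebra_simps)
  then show "\<exists>a b. euler {j} (p + q) = Const a * Var j + Const b * (Var j)\<^sup>2" by blast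
qed

lemma separable_quadratic_on_Const_mult:
  assumes "separable_quadratic_on I p"
  shows "separable_quadratic_on I (Const c * p)"
  unfolding separable_quadratic_on_def
proof
  fix j assume "j \<in> I"
  then obtain a b where "euler {j} p = Const a * Var j + Const b * (Var j)\<^sup>2"
    using assms unfolding separable_quadratic_on_def by metis
  then have "euler {j} (Const c * p) = Const (c * a) * Var j + Const (c * b) * (Var j)\<^sup>2"
    by (simp add: euler_Const_mult Const_mult distrib_left mult.assoc)
  then show "\<exists>a b. euler {j} (Const c * p) = Const a * Var j + Const b * (Var j)\<^sup>2" by blast
qed

lemma separable_quadratic_on_Const: "separable_quadratic_on I (Const c)"
  unfolding separable_quadratic_on_def
  by (intro ballI exI[of _ 0]) (simp add: Const_zero)

lemma separable_quadratic_on_Var: "separable_quadratic_on I (Var i)"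
  unfolding separable_quadratic_on_def
proof
  fix j
  have "euler {j} (Var i) = Const (if i = j then 1 else 0) * Var j + Const 0 * (Var j)\<^sup>2"
    by (simp add: Const_zero Const_one euler_Var)
  then show "\<exists>a b. euler {j} (Var i) = Const a * Var j + Const b * (Var j)\<^sup>2" by blast
qed

lemma separable_quadratic_on_Var_square: 
  "separable_quadratic_on I ((Var i)\<^sup>2 :: ('v, 'a::comm_ring_1) mpoly)"
  unfolding separable_quadratic_on_def
proof
  fix j
  have "Const 2 = (2 :: ('v, 'a) mpoly)"
    by (simp add: Const_def)
  moreover have "euler {j} ((Var i)\<^sup>2) = 2 * Var i * euler {j} (Var i :: ('v, 'a) mpoly)"
    by (simp add: euler_power)
  ultimately have "euler {j} ((Var i)\<^sup>2 :: ('v, 'a) mpoly) =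
      Const 0 * Var j + Const (if i = j then 2 else 0) * (Var j)\<^sup>2"
    by (simp add: Const_zero euler_Var power2_eq_square)
  then show "\<exists>a b. euler {j} ((Var i)\<^sup>2 :: ('v, 'a) mpoly) =
      Const a * Var j + Const b * (Var j)\<^sup>2" by blast
qed

lemma separable_quadratic_on_sum:
  assumes "\<And>i. i \<in> J \<Longrightarrow> separable_quadratic_on I (p i)"
  shows "separable_quadratic_on I (\<Sum>i\<in>J. p i)"
  using assms separable_quadratic_on_Const[of I 0]
  by (induction J rule: infinite_finite_induct) (auto simp: Const_zero intro: separable_quadratic_on_add)

lemma separable_quadratic_on_diff:
  assumes "separable_quadratic_on I p" "separable_quadratic_on I q"
  shows "separable_quadratic_on I (p - q)"
proof -
  have "Const (- 1) = (- 1 :: ('a, 'b) mpoly)"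
    using Const_add[of 1 "- 1 :: 'b"] by (simp add: Const_zero Const_one eq_neg_iff_add_eq_0 add.commute)
  then have "p - q = p + Const (- 1) * q" by simp
  then show ?thesis
    using assms by (simp only: separable_quadratic_on_add separable_quadratic_on_Const_mult)
qed

text \<open>The depth-3 shape enters here: separable quadratics form a linear space containing the
  constants, so an affine form evaluated at them stays in it.\<close>

lemma separable_quadratic_on_subst_affine:
  assumes "affine_linear V l" "\<And>v. v \<in> V \<Longrightarrow> separable_quadratic_on I (\<sigma> v)"
  shows "separable_quadratic_on I (subst \<sigma> l)"
  using assms
  by (auto simp: affine_linear_def subst_hom intro!: separable_quadratic_on_add
      separable_quadratic_on_sum separable_quadratic_on_Const_mult separable_quadratic_on_Const)

text \<open>Compare cubes: e is at most 3, which is below 27/8.\<close>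

lemma exp_third_le: "exp (1 / 3 * real n) \<le> (3 / 2) ^ n"
proof -
  have "exp (1 / 3 :: real) ^ 3 = exp 1"
    by (simp flip: exp_of_nat_mult)
  also have "\<dots> \<le> (3 / 2) ^ 3"
    using exp_le by (simp add: power3_eq_cube)
  finally have "exp (1 / 3 :: real) \<le> 3 / 2"
    by (subst (asm) power_mono_iff) auto
  then have "exp (1 / 3 :: real) ^ n \<le> (3 / 2) ^ n"
    by (intro power_mono) auto
  then show ?thesis
    by (simp flip: exp_of_nat_mult add: mult.commute)
qed

text \<open>On Boolean points \<open>g\<close> counts ones, and in characteristic 0 its vanishing
  forces all \<open>n\<close> of them, while \<open>f\<close> forces some coordinate to be
  0.\<close>

lemma unsatisfiable_prod_sum:
  "unsatisfiable n (\<Prod>i=1..n. Var i)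
    ((\<Sum>i=1..n. Var i) - Const (of_nat n) :: (nat, 'a::field_char_0) mpoly)"
  unfolding unsatisfiable_def
proof (rule notI, elim exE conjE)
  fix x :: "nat \<Rightarrow> 'a"
  assume f: "poly_eval x (\<Prod>i=1..n. Var i) = 0"
    and g: "poly_eval x ((\<Sum>i=1..n. Var i) - Const (of_nat n)) = 0"
    and b: "\<forall>i\<in>{1..n}. poly_eval x (boolean_axiom i) = 0"
  \<comment> \<open>This form turns the sum of the \<open>x i\<close> into a count of the
    ones.\<close>
  have bool: "x i = (if x i = 1 then 1 else 0)" if "i \<in> {1..n}" for i
    using b that by (auto simp: boolean_axiom_def poly_eval_hom power2_eq_square)
  obtain j where j: "j \<in> {1..n}" "x j = 0"
    using f by (auto simp: poly_eval_hom)
  have "of_nat n = (\<Sum>i=1..n. x i)"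
    using g by (simp add: poly_eval_hom)
  also have "\<dots> = (\<Sum>i=1..n. if x i = 1 then 1 else 0)"
    by (rule sum.cong[OF refl]) (rule bool)
  also have "\<dots> = of_nat (card {i\<in>{1..n}. x i = 1})"
    by (simp add: sum.If_cases Int_def)
  finally have "card {i\<in>{1..n}. x i = 1} = n"
    by (metis of_nat_eq_iff)
  moreover have "j \<notin> {i\<in>{1..n}. x i = 1}"
    using j by simp
  then have "{i\<in>{1..n}. x i = 1} \<subset> {1..n}"
    using j(1) by blast
  then have "card {i\<in>{1..n}. x i = 1} < card {1..n}"
    by (intro psubset_card_mono) auto
  ultimately show False by simp
qed

lemma refutation_lower_bound:
  fixes n :: nat and f g :: "(nat, 'a::field_char_0) mpoly"
  defines "f \<equiv> \<Prod>i=1..n. Var i"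
    and "g \<equiv> (\<Sum>i=1..n. Var i) - Const (of_nat n)"
  assumes F: "sps_ips_refutation n f g F"
  shows "3 ^ n \<le> (1 + (\<Sum>(l, d)\<leftarrow>F. d + 1)) * 2 ^ n"
proof -
  define C where "C = formula_poly F"
  define \<rho> :: "ips_var \<Rightarrow> (nat, 'a) mpoly" where
    "\<rho> = (\<lambda>v. case v of X i \<Rightarrow> Var i | Y \<Rightarrow> 0 | Z \<Rightarrow> g | W i \<Rightarrow> boolean_axiom i)"
  define P where "P = 1 - subst \<rho> C"
  let ?\<tau> = "\<lambda>v. case v of X i \<Rightarrow> Var i | Y \<Rightarrow> 0 | Z \<Rightarrow> 0 | W i \<Rightarrow> 0"
  let ?\<sigma> = "\<lambda>v. case v of X i \<Rightarrow> Var i | Y \<Rightarrow> f | Z \<Rightarrow> g | W i \<Rightarrow> boolean_axiom i"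
  have C0: "subst ?\<tau> C = (0 :: (nat, 'a) mpoly)" and C1: "subst ?\<sigma> C = 1"
    and aff: "\<And>l d. (l, d) \<in> set F \<Longrightarrow> affine_linear (ips_vars n) l"
    using F unfolding sps_ips_refutation_def ips_refutation_def is_powering_formula_def C_def
    by blast+

  \<comment> \<open>The entry \<open>(1, 0)\<close> supplies the constant 1 of \<open>P\<close> and
    accounts for the additional 1 in the bound.\<close>
  define L where "L = (1, 0) # map (\<lambda>(l, d). (subst \<rho> l, d)) F"
  \<comment> \<open>At the all-ones point \<open>g\<close> and the Boolean axioms vanish, so
    \<open>\<rho>\<close> agrees there with \<open>?\<tau>\<close>, under which \<open>C\<close>
    becomes 0.\<close>
  have "poly_eval (\<lambda>_. 1) (subst \<rho> C) = poly_eval (\<lambda>_. 1) (subst ?\<tau> C :: (nat, 'a) mpoly)"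
    unfolding poly_eval_subst
    by (rule arg_cong[where f = "\<lambda>x. poly_eval x C"])
      (auto simp: \<rho>_def g_def boolean_axiom_def poly_eval_hom fun_eq_iff split: ips_var.split)
  then have "poly_eval (\<lambda>_. 1) P = 1"
    by (simp add: P_def C0 poly_eval_hom)
  then have "P \<noteq> 0"
    by (auto simp: poly_eval_hom)
  moreover have "{1..n} \<subseteq> Poly_Mapping.keys m" if m: "m \<in> Poly_Mapping.keys P" for m
  proof
    fix j assume j: "j \<in> {1..n}"
    let ?z = "\<lambda>i. if i = j then 0 else Var i :: (nat, 'a) mpoly"
    have "subst ?z f = 0"
      using j by (auto simp: f_def subst_hom)
    \<comment> \<open>Only the value at \<open>Y\<close> differs between \<open>\<rho>\<close> and
      \<open>?\<sigma>\<close>, and x_j = 0 makes \<open>f\<close> vanish; under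
      \<open>?\<sigma>\<close> the polynomial \<open>C\<close> becomes 1.\<close>
    then have "(\<lambda>v. subst ?z (\<rho> v)) = (\<lambda>v. subst ?z (?\<sigma> v))"
      by (auto simp: \<rho>_def subst_hom fun_eq_iff split: ips_var.split)
    then have "subst ?z (subst \<rho> C) = subst ?z (subst ?\<sigma> C)"
      by (simp only: subst_comp)
    then have "subst ?z P = 0"
      by (simp add: P_def C1 subst_hom)
    then show "j \<in> Poly_Mapping.keys m"
      using m by (rule keys_if_subst_zero)
  qed
  moreover have "P \<in> mpoly.span ((\<lambda>(q, d). q ^ d) ` set L)"
  proof -
    \<comment> \<open>Stated for lists \<open>F'\<close> with entries from \<open>F\<close>, so that
      \<open>L\<close> stays fixed during the induction.\<close>
    have "(\<Sum>(l, d)\<leftarrow>F'. subst \<rho> l ^ d) \<in> mpoly.span ((\<lambda>(q, d). q ^ d) ` set L)"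
      if "set F' \<subseteq> set F" for F'
      using that
    proof (induction F')
      case (Cons x F')
      obtain l d where x: "x = (l, d)" by fastforce
      with Cons.prems have "subst \<rho> l ^ d \<in> (\<lambda>(q, d). q ^ d) ` set L"
        by (force simp: L_def)
      then show ?case
        using Cons by (simp add: x mpoly.span_add mpoly.span_base)
    qed (simp add: mpoly.span_zero)
    moreover have "1 \<in> mpoly.span ((\<lambda>(q, d). q ^ d) ` set L)"
      by (rule mpoly.span_base) (simp add: L_def)
    moreover have "P = 1 - (\<Sum>(l, d)\<leftarrow>F. subst \<rho> l ^ d)"
      by (simp add: P_def C_def formula_poly_def subst_hom case_prod_unfold)
    ultimately show ?thesis
      by (simp add: mpoly.span_diff)
  qed
  moreover have "separable_quadratic_on {1..n} q" if "(q, d) \<in> set L" for q d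
  proof -
    have "separable_quadratic_on {1..n} (\<rho> v)" for v
      using separable_quadratic_on_Const[of "{1..n}" "0 :: 'a"]
      by (auto simp: \<rho>_def g_def boolean_axiom_def Const_zero split: ips_var.split
          intro!: separable_quadratic_on_diff separable_quadratic_on_sum separable_quadratic_on_Var
            separable_quadratic_on_Var_square separable_quadratic_on_Const)
    then show ?thesis
      using that aff separable_quadratic_on_Const[of "{1..n}" "1 :: 'a"]
      by (auto simp: L_def Const_one intro: separable_quadratic_on_subst_affine)
  qed
  ultimately have "3 ^ card {1..n} \<le> (\<Sum>(q, d)\<leftarrow>L. d + 1) * 2 ^ card {1..n}"
    by (intro sum_of_powers_lower_bound) auto
  moreover have "(\<Sum>(q, d)\<leftarrow>L. d + 1) = 1 + (\<Sum>(l, d)\<leftarrow>F. d + 1)"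
    by (simp add: L_def case_prod_unfold comp_def)
  ultimately show ?thesis by simp
qed

text \<open>The constant in the exponent is 1/3, and the bound holds for every \<open>n\<close>,
  including 0.\<close>

theorem corollary7p2:
  fixes n :: nat and f g :: "(nat, 'a::field_char_0) mpoly"
  defines "f \<equiv> \<Prod>i=1..n. Var i"
    and "g \<equiv> (\<Sum>i=1..n. Var i) - Const (of_nat n)"
  shows "unsatisfiable n f g \<and>
    (\<forall>F. sps_ips_refutation n f g F \<longrightarrow>
       real (formula_size (ips_vars n) F) \<ge> exp (1 / 3 * real n))"
proof (intro conjI allI impI)
  show "unsatisfiable n f g"
    unfolding f_def g_def by (rule unsatisfiable_prod_sum)
next
  fix F assume F: "sps_ips_refutation n f g F"
  define D where "D = (\<Sum>(l, d)\<leftarrow>F. d + 1)"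
  \<comment> \<open>The empty formula computes 0, which cannot become 1 under substitution.\<close>
  have "F \<noteq> []"
    using F by (auto simp: sps_ips_refutation_def ips_refutation_def formula_poly_def subst_hom)
  then have D: "1 \<le> D"
    by (cases F) (auto simp: D_def)
  have "(3 :: nat) ^ n \<le> (1 + D) * 2 ^ n"
    using refutation_lower_bound F unfolding D_def f_def g_def .
  then have "real (3 ^ n) \<le> real ((1 + D) * 2 ^ n)"
    by (simp only: of_nat_le_iff)
  then have "(3 :: real) ^ n \<le> (1 + real D) * 2 ^ n"
    by (simp add: algebra_simps)
  then have "(3 / 2 :: real) ^ n \<le> 1 + real D"
    by (simp add: power_divide divide_le_eq)
  then have "exp (1 / 3 * real n) \<le> 1 + real D"
    using exp_third_le[of n] by linarith
  \<comment> \<open>The factor \<open>2 * n + 2\<close> of the size is at least 2 and so absorbs the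
    additional 1, as \<open>D\<close> is positive.\<close>
  moreover have "1 + D \<le> (2 * n + 2) * D"
    using D mult_right_mono[of 2 "2 * n + 2" D] by linarith
  then have "real (1 + D) \<le> real ((2 * n + 2) * D)"
    by (simp only: of_nat_le_iff)
  ultimately have "exp (1 / 3 * real n) \<le> real ((2 * n + 2) * D)"
    by linarith
  then show "exp (1 / 3 * real n) \<le> real (formula_size (ips_vars n) F)"
    by (simp only: formula_size_def card_ips_vars D_def)
qed

end
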